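(* Let $G,H$ be graphs with $\gamma(H)\ge 2$. A set $D\subseteq V(G)\times V(H)$ is a minimal dominating set of $G[H]$ if and only if: (i) $p_G(D)$ is an irreducible dominating set of $G$; and (ii) for every $x\in p_G(D)$: if $x$ is totally dominated by $p_G(D)$ in $G$ then $|p_{H,x}(D)|=1$, and if $x$ is barely dominated by $p_G(D)$ in $G$ then $p_{H,x}(D)$ is a minimal dominating set of $H$.
   Context: $\gamma$ is the domination number. The lexicographic product $G[H]$ has vertex set $V(G)\times V(H)$, with $(x_1,y_1)$ adjacent to $(x_2,y_2)$ iff $x_1x_2\in E(G)$, or $x_1=x_2$ and $y_1y_2\in E(H)$. $p_G(D)=\{x: (x,y)\in D\text{ for some }y\}$, $p_{H,x}(D)=\{y:(x,y)\in D\}$. For $S\subseteq V(G)$: $x$ is totally dominated by $S$ if $N(x)\cap S\ne\emptyset$, and barely dominated by $S$ if $N[x]\cap S=\{x\}$. A dominating set $S$ is reducible if there is $u\in S$ with $S\setminus\{u\}$ dominating and $N(S)=N(S\setminus\{u\})$, and irreducible otherwise. *)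

theory Defs
  imports "Graph_Theory.Pair_Digraph" "HOL-Library.Extended_Nat"
begin

text \<open>
  A simple undirected graph is a \<^locale>\<open>pair_bidirected_digraph\<close>: a vertex set \<^term>\<open>pverts G\<close>
  with a symmetric and irreflexive adjacency relation \<^term>\<open>parcs G\<close> on it, so that an edge
  \<open>uv\<close> is represented by the two pairs \<open>(u, v)\<close> and \<open>(v, u)\<close>. Finiteness is not required.
\<close>

definition lex_product ::
    "'a pair_pre_digraph \<Rightarrow> 'b pair_pre_digraph \<Rightarrow> ('a \<times> 'b) pair_pre_digraph" where
  "lex_product G H = \<lparr>
     pverts = pverts G \<times> pverts H,
     parcs = {((x1, y1), (x2, y2)) | x1 y1 x2 y2.
       x1 \<in> pverts G \<and> y1 \<in> pverts H \<and> x2 \<in> pverts G \<and> y2 \<in> pverts H \<and>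
       ((x1, x2) \<in> parcs G \<or> x1 = x2 \<and> (y1, y2) \<in> parcs H)} \<rparr>"

definition open_nbhd :: "'a pair_pre_digraph \<Rightarrow> 'a \<Rightarrow> 'a set" where
  "open_nbhd G x = {y. (x, y) \<in> parcs G}"

definition closed_nbhd :: "'a pair_pre_digraph \<Rightarrow> 'a \<Rightarrow> 'a set" where
  "closed_nbhd G x = insert x (open_nbhd G x)"

text \<open>
  \<open>N(S)\<close> is the union of the open neighbourhoods of the elements of \<open>S\<close>; it may meet \<open>S\<close>.
\<close>

definition open_nbhd_set :: "'a pair_pre_digraph \<Rightarrow> 'a set \<Rightarrow> 'a set" where
  "open_nbhd_set G S = (\<Union>x\<in>S. open_nbhd G x)"

definition dominating :: "'a pair_pre_digraph \<Rightarrow> 'a set \<Rightarrow> bool" where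
  "dominating G S \<longleftrightarrow> S \<subseteq> pverts G \<and> (\<forall>x\<in>pverts G. closed_nbhd G x \<inter> S \<noteq> {})"

definition minimal_dominating :: "'a pair_pre_digraph \<Rightarrow> 'a set \<Rightarrow> bool" where
  "minimal_dominating G S \<longleftrightarrow> dominating G S \<and> (\<forall>T. T \<subset> S \<longrightarrow> \<not> dominating G T)"

text \<open>
  The value is \<open>\<infinity>\<close> if there is no finite dominating set.
\<close>

definition domination_number :: "'a pair_pre_digraph \<Rightarrow> enat" where
  "domination_number G =
     (INF S\<in>{S. dominating G S}. if finite S then enat (card S) else \<infinity>)"

definition totally_dominated :: "'a pair_pre_digraph \<Rightarrow> 'a set \<Rightarrow> 'a \<Rightarrow> bool" where
  "totally_dominated G S x \<longleftrightarrow> open_nbhd G x \<inter> S \<noteq> {}"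

definition barely_dominated :: "'a pair_pre_digraph \<Rightarrow> 'a set \<Rightarrow> 'a \<Rightarrow> bool" where
  "barely_dominated G S x \<longleftrightarrow> closed_nbhd G x \<inter> S = {x}"

definition reducible_dominating :: "'a pair_pre_digraph \<Rightarrow> 'a set \<Rightarrow> bool" where
  "reducible_dominating G S \<longleftrightarrow> dominating G S \<and>
     (\<exists>u\<in>S. dominating G (S - {u}) \<and> open_nbhd_set G S = open_nbhd_set G (S - {u}))"

definition irreducible_dominating :: "'a pair_pre_digraph \<Rightarrow> 'a set \<Rightarrow> bool" where
  "irreducible_dominating G S \<longleftrightarrow> dominating G S \<and> \<not> reducible_dominating G S"

definition proj_fst :: "('a \<times> 'b) set \<Rightarrow> 'a set" where
  "proj_fst D = {x. \<exists>y. (x, y) \<in> D}"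

definition fibre :: "'a \<Rightarrow> ('a \<times> 'b) set \<Rightarrow> 'b set" where
  "fibre x D = {y. (x, y) \<in> D}"

lemma pair_bidirected_digraph_lex_product:
  assumes "pair_bidirected_digraph G" "pair_bidirected_digraph H"
  shows "pair_bidirected_digraph (lex_product G H)"
proof -
  interpret G: pair_bidirected_digraph G by fact
  interpret H: pair_bidirected_digraph H by fact
  have symG: "(b, a) \<in> parcs G" if "(a, b) \<in> parcs G" for a b
    using G.pair_sym_arcs that by (auto simp: symmetric_def dest: symD)
  have symH: "(b, a) \<in> parcs H" if "(a, b) \<in> parcs H" for a b
    using H.pair_sym_arcs that by (auto simp: symmetric_def dest: symD)
  show ?thesis
    by unfold_locales
      (auto simp: lex_product_def symmetric_def intro!: symI
        dest: symG symH G.pair_no_loops H.pair_no_loops)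
qed

lemma domination_number_finite:
  assumes "finite (pverts G)"
  shows "domination_number G = enat (Min (card ` {S. dominating G S}))"
proof -
  let ?F = "{S. dominating G S}"
  have sub: "?F \<subseteq> Pow (pverts G)" by (auto simp: dominating_def)
  have fin: "finite ?F" using finite_subset[OF sub] assms by simp
  have "dominating G (pverts G)" by (auto simp: dominating_def closed_nbhd_def)
  then have ne: "?F \<noteq> {}" by blast
  have finS: "finite S" if "S \<in> ?F" for S
    using that sub assms finite_subset by blast
  have M: "Min (card ` ?F) \<in> card ` ?F" using fin ne by (intro Min_in) auto
  then obtain T where T: "T \<in> ?F" "card T = Min (card ` ?F)" by auto
  show ?thesis unfolding domination_number_def
  proof (rule antisym)
    show "(INF S\<in>?F. if finite S then enat (card S) else \<infinity>) \<le> enat (Min (card ` ?F))"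
      by (rule INF_lower2[OF T(1)]) (use T finS in simp)
    show "enat (Min (card ` ?F)) \<le> (INF S\<in>?F. if finite S then enat (card S) else \<infinity>)"
      by (rule INF_greatest) (use fin in auto)
  qed
qed

end

theory Submission
  imports Defs
begin

text \<open>
  A set \<open>D\<close> dominates \<open>G[H]\<close> iff every vertex \<open>x\<close> of \<open>G\<close> has a neighbour in \<open>p\<^sub>G(D)\<close> or the
  fibre of \<open>D\<close> over \<open>x\<close> dominates \<open>H\<close>. So over a totally dominated vertex a fibre matters only
  through being nonempty, and over a barely dominated one it must dominate \<open>H\<close> by itself. A whole
  fibre over \<open>u\<close> can be dropped precisely when \<open>u\<close> witnesses that \<open>p\<^sub>G(D)\<close> is reducible: a vertex
  whose only neighbour in \<open>p\<^sub>G(D)\<close> is \<open>u\<close> would afterwards need a dominating fibre, but this fibre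
  has at most one element, whereas \<open>\<gamma>(H) \<ge> 2\<close>.
\<close>

lemma parcs_sym:
  assumes "pair_bidirected_digraph G" "(a, b) \<in> parcs G"
  shows "(b, a) \<in> parcs G"
proof -
  interpret pair_bidirected_digraph G by fact
  show ?thesis
    using pair_sym_arcs assms(2) by (auto simp: symmetric_def dest: symD)
qed

text \<open>Edges are symmetric. This turns the equation between neighbourhoods in reducibility into
  a condition on which vertices are totally dominated.\<close>

lemma mem_open_nbhd_set_iff_totally_dominated:
  assumes "pair_bidirected_digraph G"
  shows "x \<in> open_nbhd_set G S \<longleftrightarrow> totally_dominated G S x"
  using parcs_sym[OF assms]
  by (auto simp: open_nbhd_set_def open_nbhd_def totally_dominated_def)

lemma totally_dominated_in_pverts:
  assumes "pair_bidirected_digraph G" "totally_dominated G S x"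
  shows "x \<in> pverts G"
proof -
  interpret pair_bidirected_digraph G by fact
  show ?thesis
    using assms(2) by (auto simp: totally_dominated_def open_nbhd_def dest: in_arcsD1)
qed

lemma totally_dominated_mono:
  "totally_dominated G S x \<Longrightarrow> S \<subseteq> T \<Longrightarrow> totally_dominated G T x"
  by (auto simp: totally_dominated_def)

lemma dominating_iff_totally_dominated_or_mem:
  "dominating G S \<longleftrightarrow> S \<subseteq> pverts G \<and> (\<forall>x\<in>pverts G. totally_dominated G S x \<or> x \<in> S)"
  by (auto simp: dominating_def closed_nbhd_def totally_dominated_def)

text \<open>As there are no loops, \<open>x\<close> is not in its own open neighbourhood. So the two
  cases of (ii) are exclusive and exhaust the projection.\<close>

lemma barely_dominated_iff:
  assumes "pair_bidirected_digraph G"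
  shows "barely_dominated G S x \<longleftrightarrow> x \<in> S \<and> \<not> totally_dominated G S x"
proof -
  interpret pair_bidirected_digraph G by fact
  have "x \<notin> open_nbhd G x"
    using pair_no_loops by (fastforce simp: open_nbhd_def)
  then show ?thesis
    by (auto simp: barely_dominated_def closed_nbhd_def totally_dominated_def)
qed

text \<open>This form excludes the empty set and singletons at once; both exclusions are used
  below.\<close>

lemma dominating_not_subset_singleton:
  assumes "domination_number H \<ge> 2" "dominating H S"
  shows "\<not> S \<subseteq> {y}"
proof
  assume "S \<subseteq> {y}"
  then have fin: "finite S" and card: "card S \<le> 1"
    using finite_subset card_mono[of "{y}" S] by auto
  note assms(1)
  also have "domination_number H \<le> (if finite S then enat (card S) else \<infinity>)"
    unfolding domination_number_def by (rule INF_lower) (use assms(2) in simp)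
  also have "\<dots> = enat (card S)"
    using fin by simp
  finally show False
    using card by (simp add: numeral_eq_enat)
qed

lemma proj_fst_iff_fibre: "x \<in> proj_fst D \<longleftrightarrow> fibre x D \<noteq> {}"
  by (auto simp: proj_fst_def fibre_def)

text \<open>A point of \<open>D\<close> over a neighbour of \<open>x\<close> dominates every
  \<open>(x, y)\<close>. Without such a point, each \<open>(x, y)\<close> must be dominated inside
  the fibre over \<open>x\<close>. The first alternative does not depend on \<open>y\<close>, so the
  quantifier over \<open>y\<close> moves into the second.\<close>

lemma dominating_lex_product_iff:
  assumes "pverts H \<noteq> {}" "D \<subseteq> pverts G \<times> pverts H"
  shows "dominating (lex_product G H) D \<longleftrightarrow>
    (\<forall>x\<in>pverts G. totally_dominated G (proj_fst D) x \<or> dominating H (fibre x D))"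
proof -
  have nb: "closed_nbhd (lex_product G H) (x, y) \<inter> D \<noteq> {} \<longleftrightarrow>
      totally_dominated G (proj_fst D) x \<or> closed_nbhd H y \<inter> fibre x D \<noteq> {}"
    if "x \<in> pverts G" "y \<in> pverts H" for x y
  proof -
    have "d \<in> closed_nbhd (lex_product G H) (x, y) \<longleftrightarrow>
        fst d \<in> open_nbhd G x \<or> fst d = x \<and> snd d \<in> closed_nbhd H y" if "d \<in> D" for d
      using assms(2) \<open>x \<in> pverts G\<close> \<open>y \<in> pverts H\<close> that
      by (cases d) (auto simp: closed_nbhd_def open_nbhd_def lex_product_def)
    then have "closed_nbhd (lex_product G H) (x, y) \<inter> D =
        {d \<in> D. fst d \<in> open_nbhd G x \<or> fst d = x \<and> snd d \<in> closed_nbhd H y}"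
      by blast
    then show ?thesis
      by (auto simp: totally_dominated_def proj_fst_def fibre_def)
  qed
  have sub: "fibre x D \<subseteq> pverts H" for x
    using assms(2) by (auto simp: fibre_def)
  have V: "pverts (lex_product G H) = pverts G \<times> pverts H"
    by (simp add: lex_product_def)
  have "dominating (lex_product G H) D \<longleftrightarrow>
      (\<forall>x\<in>pverts G. \<forall>y\<in>pverts H. closed_nbhd (lex_product G H) (x, y) \<inter> D \<noteq> {})"
    using assms(2) by (auto simp: dominating_def V)
  also have "\<dots> \<longleftrightarrow> (\<forall>x\<in>pverts G. \<forall>y\<in>pverts H.
      totally_dominated G (proj_fst D) x \<or> closed_nbhd H y \<inter> fibre x D \<noteq> {})"
    by (simp add: nb)
  also have "\<dots> \<longleftrightarrow>
      (\<forall>x\<in>pverts G. totally_dominated G (proj_fst D) x \<or> dominating H (fibre x D))"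
    using assms(1) sub by (auto simp: dominating_def)
  finally show ?thesis .
qed

theorem theorem8:
  fixes G :: "'a pair_pre_digraph" and H :: "'b pair_pre_digraph"
    and D :: "('a \<times> 'b) set"
  assumes "pair_bidirected_digraph G"
    and "pair_bidirected_digraph H"
    and "domination_number H \<ge> 2"
    and "D \<subseteq> pverts G \<times> pverts H"
  shows "minimal_dominating (lex_product G H) D \<longleftrightarrow>
    irreducible_dominating G (proj_fst D) \<and>
    (\<forall>x\<in>proj_fst D.
      (totally_dominated G (proj_fst D) x \<longrightarrow> card (fibre x D) = 1) \<and>
      (barely_dominated G (proj_fst D) x \<longrightarrow> minimal_dominating H (fibre x D)))"
    (is "?L \<longleftrightarrow> ?I \<and> ?F")
proof -
  let ?P = "proj_fst D"
  note two = dominating_not_subset_singleton[OF assms(3)]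
  \<comment> \<open>In a graph without vertices the empty set would dominate.\<close>
  have "pverts H \<noteq> {}"
    using two[of "{}" undefined] by (auto simp: dominating_def)
  note dom_iff = dominating_lex_product_iff[OF this]
  have fib_ne: "S \<noteq> {}" if "dominating H S" for S
    using two[OF that, of undefined] by auto
  note barely = barely_dominated_iff[OF assms(1)]
  note open_set = mem_open_nbhd_set_iff_totally_dominated[OF assms(1)]
  have P_sub: "?P \<subseteq> pverts G"
    using assms(4) by (auto simp: proj_fst_def)
  \<comment> \<open>A vertex with no neighbour in the projection has a dominating, hence nonempty,
    fibre, so it lies in the projection itself.\<close>
  have dom_proj: "dominating G (proj_fst T)"
    if "dominating (lex_product G H) T" "T \<subseteq> D" for T
  proof -
    have T: "T \<subseteq> pverts G \<times> pverts H"
      using that assms(4) by blast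
    then have "proj_fst T \<subseteq> pverts G"
      by (auto simp: proj_fst_def)
    moreover have "totally_dominated G (proj_fst T) x \<or> x \<in> proj_fst T" if "x \<in> pverts G" for x
      using \<open>dominating (lex_product G H) T\<close> that fib_ne[of "fibre x T"]
      unfolding dom_iff[OF T] proj_fst_iff_fibre by blast
    ultimately show ?thesis
      by (simp add: dominating_iff_totally_dominated_or_mem)
  qed
  show ?thesis
  proof
    assume L: ?L
    then have dom: "totally_dominated G ?P x \<or> dominating H (fibre x D)" if "x \<in> pverts G" for x
      using that dom_iff[OF assms(4)] by (auto simp: minimal_dominating_def)
    have minD: "T = D" if "T \<subseteq> D"
      and "\<And>x. x \<in> pverts G \<Longrightarrow> totally_dominated G (proj_fst T) x \<or> dominating H (fibre x T)"
    for T
    proof -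
      have "T \<subseteq> pverts G \<times> pverts H"
        using that assms(4) by blast
      then have "dominating (lex_product G H) T"
        using that dom_iff by blast
      then show ?thesis
        using L that(1) by (auto simp: minimal_dominating_def)
    qed
    \<comment> \<open>Cutting one fibre down to a nonempty \<open>A\<close> leaves the projection
      and all other fibres unchanged, so domination can only fail over \<open>x\<close>.\<close>
    have shrink: "A = fibre x D"
      if x: "x \<in> ?P" and A: "A \<subseteq> fibre x D" "A \<noteq> {}"
        and ok: "totally_dominated G ?P x \<or> dominating H A" for x A
    proof -
      let ?T = "{d \<in> D. fst d = x \<longrightarrow> snd d \<in> A}"
      have fib: "fibre z ?T = (if z = x then A else fibre z D)" for z
        using A(1) by (auto simp: fibre_def)
      then have "proj_fst ?T = ?P"
        using x A(2) by (auto simp: proj_fst_iff_fibre split: if_splits)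
      then have "?T = D"
        using ok dom by (intro minD) (simp_all add: fib)
      then show ?thesis
        using fib[of x] by simp
    qed
    have ?I
      unfolding irreducible_dominating_def
    proof (intro conjI notI)
      show "dominating G ?P"
        using L by (intro dom_proj) (auto simp: minimal_dominating_def)
      assume "reducible_dominating G ?P"
      then obtain u where u: "u \<in> ?P" "dominating G (?P - {u})"
        and eq: "open_nbhd_set G ?P = open_nbhd_set G (?P - {u})"
        by (auto simp: reducible_dominating_def)
      \<comment> \<open>Dropping the whole fibre over the redundant vertex \<open>u\<close> should
        preserve domination, against minimality.\<close>
      let ?T = "{d \<in> D. fst d \<noteq> u}"
      have proj: "proj_fst ?T = ?P - {u}"
        by (auto simp: proj_fst_def)
      have "?T = D"
      proof (intro minD)
        fix x assume x: "x \<in> pverts G"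
        show "totally_dominated G (proj_fst ?T) x \<or> dominating H (fibre x ?T)"
        proof (cases "totally_dominated G ?P x")
          case True
          then show ?thesis
            using eq open_set proj by metis
        next
          case False
          then have "\<not> totally_dominated G (?P - {u}) x"
            using totally_dominated_mono[of G "?P - {u}" x ?P] by auto
          \<comment> \<open>\<open>u\<close> is dominated by a set that omits it, hence totally
            dominated by that set, whereas \<open>x\<close> is not.\<close>
          then have "x \<noteq> u"
            using u(2) x by (auto simp: dominating_iff_totally_dominated_or_mem)
          then have "fibre x ?T = fibre x D"
            by (auto simp: fibre_def)
          then show ?thesis
            using dom[OF x] False by simp
        qed
      qed auto
      then show False
        using u(1) proj by auto
    qed
    moreover have ?F
    proof (intro ballI conjI impI)
      fix x assume x: "x \<in> ?P"
      then obtain y where y: "y \<in> fibre x D"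
        by (auto simp: proj_fst_iff_fibre)
      show "card (fibre x D) = 1" if "totally_dominated G ?P x"
      proof -
        \<comment> \<open>Over a totally dominated vertex any one point of the fibre
          suffices.\<close>
        have "{y} = fibre x D"
          using y that by (intro shrink[OF x]) auto
        then show ?thesis
          by (metis is_singletonI is_singleton_altdef)
      qed
      show "minimal_dominating H (fibre x D)" if "barely_dominated G ?P x"
        unfolding minimal_dominating_def
      proof (intro conjI allI impI notI)
        show "dominating H (fibre x D)"
          using dom[of x] that x P_sub barely by blast
        fix T assume "T \<subset> fibre x D" "dominating H T"
        then show False
          using shrink[OF x, of T] fib_ne[of T] by blast
      qed
    qed
    ultimately show "?I \<and> ?F" ..
  next
    assume R: "?I \<and> ?F"
    then have P_dom: "dominating G ?P" and irred: "\<not> reducible_dominating G ?P"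
      by (auto simp: irreducible_dominating_def)
    have single: "card (fibre x D) = 1" if "x \<in> ?P" "totally_dominated G ?P x" for x
      using R that by blast
    have minF: "minimal_dominating H (fibre x D)"
      if "x \<in> ?P" "\<not> totally_dominated G ?P x" for x
      using R that barely by blast
    show ?L
      unfolding minimal_dominating_def
    proof (intro conjI allI impI notI)
      \<comment> \<open>A vertex not totally dominated by the projection belongs to it, so (ii)
        gives it a dominating fibre.\<close>
      show "dominating (lex_product G H) D"
        using P_dom minF unfolding dom_iff[OF assms(4)]
        by (auto simp: dominating_iff_totally_dominated_or_mem[of G] minimal_dominating_def)
      fix T assume T: "T \<subset> D" and dT: "dominating (lex_product G H) T"
      let ?Q = "proj_fst T"
      have "T \<subseteq> pverts G \<times> pverts H"
        using T assms(4) by blast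
      from dom_iff[OF this] dT
      have domT: "totally_dominated G ?Q z \<or> dominating H (fibre z T)" if "z \<in> pverts G" for z
        using that by blast
      have fib_sub: "fibre z T \<subseteq> fibre z D" for z
        using T by (auto simp: fibre_def)
      have Q_sub: "?Q \<subseteq> ?P"
        using T by (auto simp: proj_fst_def)
      obtain x y where xy: "(x, y) \<in> D" "(x, y) \<notin> T"
        using T by auto
      then have x: "x \<in> ?P"
        by (auto simp: proj_fst_def)
      show False
      proof (cases "totally_dominated G ?P x")
        case True
        then have "fibre x D = {y}"
          using single[OF x] xy(1) by (metis card_1_singletonE fibre_def mem_Collect_eq singletonD)
        \<comment> \<open>The fibre over \<open>x\<close> was the single point \<open>y\<close>,
          which \<open>T\<close> lacks, so \<open>x\<close> leaves the projection. It remains to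
          show that \<open>x\<close> witnesses reducibility.\<close>
        then have Q: "?Q \<subseteq> ?P - {x}"
          using Q_sub xy(2) fib_sub[of x] by (auto simp: proj_fst_iff_fibre fibre_def)
        \<comment> \<open>Otherwise the fibre of \<open>T\<close> over \<open>z\<close> would
          dominate \<open>H\<close> while lying in a one-element fibre of \<open>D\<close>.\<close>
        have TQ: "totally_dominated G ?Q z" if z: "totally_dominated G ?P z" for z
        proof (rule ccontr)
          assume "\<not> totally_dominated G ?Q z"
          then have d: "dominating H (fibre z T)"
            using domT totally_dominated_in_pverts[OF assms(1) z] by blast
          then have "z \<in> ?P"
            using fib_ne[OF d] fib_sub[of z] by (auto simp: proj_fst_iff_fibre)
          then obtain w where "fibre z D = {w}"
            using single z card_1_singletonE by metis
          then show False
            using two[OF d, of w] fib_sub[of z] by simp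
        qed
        have "open_nbhd_set G ?P = open_nbhd_set G (?P - {x})"
        proof (intro set_eqI iffI)
          fix z assume "z \<in> open_nbhd_set G ?P"
          then show "z \<in> open_nbhd_set G (?P - {x})"
            unfolding open_set by (rule totally_dominated_mono[OF TQ Q])
        qed (auto simp: open_nbhd_set_def)
        moreover have "dominating G (?P - {x})"
        proof -
          have "dominating G ?Q"
            using dom_proj[OF dT] T by blast
          with Q P_sub show ?thesis
            unfolding dominating_def by blast
        qed
        ultimately show False
          using irred P_dom x by (auto simp: reducible_dominating_def)
      next
        case False
        then have "\<not> totally_dominated G ?Q x"
          using totally_dominated_mono[OF _ Q_sub] by auto
        \<comment> \<open>With no neighbour of \<open>x\<close> in the projection, the fibre of
          \<open>T\<close> must dominate alone, yet it lacks \<open>y\<close>, against minimality of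
          the fibre of \<open>D\<close>.\<close>
        then have "dominating H (fibre x T)"
          using domT x P_sub by blast
        moreover have "fibre x T \<subset> fibre x D"
          using fib_sub[of x] xy by (auto simp: fibre_def)
        ultimately show False
          using minF[OF x False] by (auto simp: minimal_dominating_def)
      qed
    qed
  qed
qed

end
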